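(* Let $1 < p < \infty$ and let $Q_0 \subset \mathbb{R}$ be a bounded interval. Then there is a function $g_0 : Q_0 \to \mathbb{R}$ such that $g_0 \in VJN_p(Q_0) \setminus L^p(Q_0)$.
   Context: For an integrable function $h$ on an interval $J$ write $h_J := \frac{1}{|J|}\int_J h$. For a bounded interval $Q_0 \subset \mathbb{R}$ and $1<p<\infty$, a function $h$ belongs to $JN_p(Q_0)$ if $h \in L^1(Q_0)$ and there is a constant $K<\infty$ such that $\sum_{i=1}^\infty |Q_i| \left( \frac{1}{|Q_i|}\int_{Q_i} |h - h_{Q_i}| \right)^p \leq K^p$ for all countable collections of pairwise disjoint intervals $(Q_i)_{i=1}^\infty$ contained in $Q_0$. A function $h$ belongs to $VJN_p(Q_0)$ if $h \in JN_p(Q_0)$ and $\lim_{a\to 0} \sup \sum_{i=1}^\infty |Q_i| \left( \frac{1}{|Q_i|}\int_{Q_i} |h - h_{Q_i}| \right)^p = 0$, where for each $a>0$ the supremum is over all collections of pairwise disjoint intervals $Q_i \subset Q_0$ each of length at most $a$. *)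

theory Defs
  imports "HOL-Analysis.Analysis"
begin

text \<open>
  Functions \<open>Q0 \<rightarrow> \<real>\<close> are represented by total functions \<open>real \<Rightarrow> real\<close> (not by a.e. classes);
  all definitions below depend only on the values on \<open>Q0\<close>.
  Integrals and lengths refer to Lebesgue measure. Intervals may be open, closed or half-open,
  but have positive length, since averages divide by the length.
\<close>

definition bounded_interval :: "real set \<Rightarrow> bool" where
  "bounded_interval Q \<longleftrightarrow> is_interval Q \<and> bounded Q \<and> 0 < measure lebesgue Q"

definition avg :: "real set \<Rightarrow> (real \<Rightarrow> real) \<Rightarrow> real" where
  "avg Q h = (1 / measure lebesgue Q) * (LINT x:Q|lebesgue. h x)"

definition mean_osc :: "real set \<Rightarrow> (real \<Rightarrow> real) \<Rightarrow> real" where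
  "mean_osc Q h = avg Q (\<lambda>x. \<bar>h x - avg Q h\<bar>)"

text \<open>
  Finite collections are included: they do not change any of the suprema below.
  Since the members of a collection are nonempty, a pairwise disjoint family has no
  repetitions and may be given as a set of intervals.
\<close>

definition disjoint_intervals :: "real set \<Rightarrow> real set set set" where
  "disjoint_intervals Q0 =
     {\<Q>. countable \<Q> \<and> disjoint \<Q> \<and> (\<forall>Q\<in>\<Q>. bounded_interval Q \<and> Q \<subseteq> Q0)}"

definition JN_sum :: "real \<Rightarrow> (real \<Rightarrow> real) \<Rightarrow> real set set \<Rightarrow> ennreal" where
  "JN_sum p h \<Q> = (\<Sum>\<^sub>\<infinity>Q\<in>\<Q>. ennreal (measure lebesgue Q * mean_osc Q h powr p))"

definition JN :: "real \<Rightarrow> real set \<Rightarrow> (real \<Rightarrow> real) set" where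
  "JN p Q0 = {h. set_integrable lebesgue Q0 h \<and>
     (\<exists>K::real. 0 \<le> K \<and> (\<forall>\<Q>\<in>disjoint_intervals Q0. JN_sum p h \<Q> \<le> ennreal (K powr p)))}"

definition VJN :: "real \<Rightarrow> real set \<Rightarrow> (real \<Rightarrow> real) set" where
  "VJN p Q0 = {h. h \<in> JN p Q0 \<and>
     ((\<lambda>a. SUP \<Q>\<in>{\<Q>\<in>disjoint_intervals Q0. \<forall>Q\<in>\<Q>. measure lebesgue Q \<le> a}. JN_sum p h \<Q>)
        \<longlongrightarrow> 0) (at_right (0::real))}"

definition Lp :: "real \<Rightarrow> real set \<Rightarrow> (real \<Rightarrow> real) set" where
  "Lp p Q0 = {h. set_borel_measurable lebesgue Q0 h \<and>
     set_integrable lebesgue Q0 (\<lambda>x. \<bar>h x\<bar> powr p)}"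

end

theory Submission
  imports Defs
begin

text \<open>
  The function is \<open>g = (\<Sum>k. (k + 1) powr (-1/p) * u\<^sub>k)\<close> with \<open>u\<^sub>k = v\<^sub>k powr (1/p)\<close>, where
  \<open>v\<^sub>k(x) = (\<Prod>j<k. 1 + sin (n\<^sub>j x) / 2)\<close> is a Riesz product whose frequencies \<open>n\<^sub>j\<close> grow so fast
  that, on all intervals that are not too short, each new factor is nearly independent of the
  earlier ones.  Two averages of one factor decide everything.  The factor itself has mean \<open>1\<close>, so the
  integral of \<open>v\<^sub>k = u\<^sub>k powr p\<close> over an interval hardly changes once \<open>k\<close> is large enough
  for that interval (\<open>riesz_integral_comparable\<close>).  Its \<open>p\<close>-th root has mean less than \<open>1\<close>, by strict
  concavity, so the integrals of the \<open>u\<^sub>k\<close> decay geometrically (\<open>riesz_root_integral_Suc\<close>).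

  In \<open>L\<^sup>p\<close> all \<open>u\<^sub>k\<close> therefore have about the same size: \<open>\<integral> g powr p\<close> dominates
  \<open>\<Sum>k. 1/(k + 1) * \<integral> v\<^sub>k\<close>, which diverges like the harmonic series, and \<open>g\<close> is not in \<open>L\<^sup>p\<close>
  (\<open>layers_not_Lp\<close>).

  An interval \<open>Q\<close>, on the other hand, sees only one layer \<open>u\<^sub>k\<close>.  Its level \<open>k\<close> is
  determined by \<open>r\<^sub>k \<le> \<bar>Q\<bar> \<le> r\<^sub>k\<^sub>-\<^sub>1\<close> (only the lower bound for \<open>k = 0\<close>), where the scale \<open>r\<^sub>k\<close> lies between the wavelengths of the layers
  \<open>k\<close> and \<open>k + 1\<close>.  The coarser layers are nearly constant on \<open>Q\<close>, and the finer layers have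
  averages over \<open>Q\<close> that decay geometrically.  So the mean oscillation of
  \<open>g\<close> is at most a constant times \<open>(k + 1) powr (-1/p)\<close> times the average of \<open>u\<^sub>k\<close>, and by
  Jensen's inequality (\<open>mean_osc_powr_le\<close>)
  \<open>\<bar>Q\<bar> * osc powr p \<le> C / (k + 1) * \<integral>\<^bsub>Q\<^esub> v\<^sub>k \<le> 2 * C / (k + 1) * \<integral>\<^bsub>Q\<^esub> v\<^sub>N\<close> for all \<open>N \<ge> k\<close>.
  In a finite disjoint family all intervals can use the same \<open>N\<close>.  The integrals on the right then
  add up to at most \<open>\<integral> v\<^sub>N\<close> over \<open>Q0\<close>, which is bounded independently of \<open>N\<close>
  (\<open>layers_JN_sum_le\<close>).  This gives \<open>JN\<close>; short intervals have large \<open>k\<close>, and the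
  factor \<open>1/(k + 1)\<close> gives \<open>VJN\<close>.
\<close>

section \<open>Elementary inequalities\<close>

text \<open>
  The quantitative form of strict concavity: averaged over a period of \<open>t = sin y / 2\<close>, the
  quadratic term is what makes the mean of \<open>(1 + t) powr q\<close> smaller than \<open>1\<close>.  The constant is
  small enough for the difference of the two sides to be convex on \<open>[-1/2, 1/2]\<close>, with horizontal
  tangent at \<open>0\<close>.
\<close>
lemma powr_le_quadratic:
  fixes q t :: real
  assumes q: "0 < q" "q < 1" and t: "\<bar>t\<bar> \<le> 1/2"
  shows "(1 + t) powr q \<le> 1 + q * t - q * (1 - q) / 8 * t\<^sup>2"
proof -
  define c where "c = q * (1 - q) / 8"
  define I where "I = {-1/2..1/2::real}"
  define f where "f s = 1 + q * s - c * s\<^sup>2 - (1 + s) powr q" for s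
  have c: "c \<ge> 0" using q by (simp add: c_def)
  have conv: "convex_on I f"
  proof (rule f''_ge0_imp_convex)
    show "convex I" by (simp add: I_def)
    fix s assume s: "s \<in> I"
    then have s1: "0 < 1 + s" "1 + s \<le> 3/2" by (auto simp: I_def)
    show "(f has_real_derivative q - 2 * c * s - q * (1 + s) powr (q - 1)) (at s)"
      unfolding f_def using s1 by (auto intro!: derivative_eq_intros)
    show "((\<lambda>s. q - 2 * c * s - q * (1 + s) powr (q - 1)) has_real_derivative
           q * (1 - q) * (1 + s) powr (q - 2) - 2 * c) (at s)"
      using s1 by (auto intro!: derivative_eq_intros simp: algebra_simps)
    have "1 / 4 \<le> (2/3::real) powr 2" by (simp add: powr_numeral power2_eq_square)
    also have "\<dots> = (3/2) powr (-2)" by (simp add: powr_minus powr_divide field_simps)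
    also have "\<dots> \<le> (3/2) powr (q - 2)" using q by (intro powr_mono) auto
    also have "\<dots> \<le> (1 + s) powr (q - 2)" using s1 q by (intro powr_mono2') auto
    finally have "q * (1 - q) * (1 / 4) \<le> q * (1 - q) * (1 + s) powr (q - 2)"
      using q by (intro mult_left_mono) auto
    then show "0 \<le> q * (1 - q) * (1 + s) powr (q - 2) - 2 * c" by (simp add: c_def)
  qed
  have "(f has_real_derivative 0) (at 0 within I)"
    unfolding f_def by (auto intro!: derivative_eq_intros)
  moreover have "0 \<in> interior I" by (simp add: I_def)
  moreover have "t \<in> I" using t by (auto simp: I_def)
  ultimately have "f t - f 0 \<ge> 0 * (t - 0)"
    by (intro convex_on_imp_above_tangent[OF conv]) (auto simp: I_def)
  then show ?thesis by (simp add: f_def c_def)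
qed

lemma sum_powr_superadditive:
  fixes x :: "'i \<Rightarrow> real"
  assumes "finite A" "\<And>i. i \<in> A \<Longrightarrow> 0 \<le> x i" "1 \<le> p"
  shows "(\<Sum>i\<in>A. x i powr p) \<le> (\<Sum>i\<in>A. x i) powr p"
proof -
  let ?S = "\<Sum>i\<in>A. x i"
  have S: "0 \<le> ?S" using assms by (simp add: sum_nonneg)
  have split: "y powr p = y * y powr (p - 1)" if "0 \<le> y" for y
    using that powr_mult_base[of y "p - 1"] by simp
  have "(\<Sum>i\<in>A. x i powr p) \<le> (\<Sum>i\<in>A. x i * ?S powr (p - 1))"
  proof (rule sum_mono)
    fix i assume i: "i \<in> A"
    have "x i \<le> ?S" using assms i by (intro member_le_sum) auto
    then show "x i powr p \<le> x i * ?S powr (p - 1)"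
      using assms i by (subst split) (auto intro!: mult_left_mono powr_mono2)
  qed
  also have "\<dots> = ?S powr p" using split[OF S] by (simp add: sum_distrib_right)
  finally show ?thesis .
qed

lemma continuous_imp_integrable_on_interval [intro]:
  fixes f :: "real \<Rightarrow> real"
  assumes "continuous_on UNIV f"
  shows "f integrable_on {a..b}"
  using assms by (metis continuous_on_subset integrable_continuous_real subset_UNIV)

text \<open>
  Jensen's inequality for \<open>y powr p\<close>, obtained by integrating Young's inequality for the
  product of \<open>u x\<close> and \<open>z powr (p - 1)\<close>, where \<open>z\<close> is the mean of \<open>u\<close>.
\<close>
lemma powr_mean_le:
  fixes u :: "real \<Rightarrow> real"
  assumes p: "1 < p" and ab: "a < b" and u: "continuous_on UNIV u" "\<And>x. 0 < u x"
  shows "(b - a) * (integral {a..b} u / (b - a)) powr p \<le> integral {a..b} (\<lambda>x. u x powr p)"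
proof -
  define z where "z = integral {a..b} u / (b - a)"
  define p' where "p' = p / (p - 1)"
  have p': "1 < p'" "1 / p + 1 / p' = 1" "(p - 1) * p' = p"
    using p by (auto simp: p'_def field_simps)
  have "0 \<le> integral {a..b} u"
    using u by (intro integral_nonneg continuous_imp_integrable_on_interval) (auto intro: less_imp_le)
  then have z: "0 \<le> z" using ab by (simp add: z_def)
  have up: "continuous_on UNIV (\<lambda>x. u x powr p)"
    using u by (intro continuous_intros) (auto simp: less_imp_neq[symmetric])
  have Iu: "integral {a..b} u = (b - a) * z" using ab by (simp add: z_def)
  have zz: "z * z powr (p - 1) = z powr p" using powr_mult_base[OF z, of "p - 1"] by simp
  have "integral {a..b} (\<lambda>x. u x * z powr (p - 1))
      \<le> integral {a..b} (\<lambda>x. u x powr p / p + z powr p / p')"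
  proof (rule integral_le)
    show "u x * z powr (p - 1) \<le> u x powr p / p + z powr p / p'" for x
      using Youngs_inequality[OF p p'(1,2), of "u x" "z powr (p - 1)"] u(2)[of x] p'(3)
      by (simp add: powr_powr)
  qed (use p' in \<open>auto intro!: continuous_imp_integrable_on_interval continuous_intros u up\<close>)
  also have "\<dots> = integral {a..b} (\<lambda>x. u x powr p) / p + (b - a) * z powr p / p'"
    using ab up p p' by (subst integral_add)
      (auto intro!: continuous_imp_integrable_on_interval continuous_intros)
  finally have "(b - a) * (z * z powr (p - 1)) \<le> integral {a..b} (\<lambda>x. u x powr p) / p + (b - a) * z powr p / p'"
    by (simp add: Iu mult.assoc)
  then have "(b - a) * z powr p * (1 - 1 / p') \<le> integral {a..b} (\<lambda>x. u x powr p) / p"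
    unfolding zz right_diff_distrib by simp
  moreover have "1 - 1 / p' = 1 / p" using p'(2) by simp
  ultimately show ?thesis using p by (simp add: z_def divide_le_cancel)
qed

section \<open>Integrals against fast oscillations\<close>

text \<open>
  A Riemann--Lebesgue estimate from one integration by parts.  The error is relative to the
  integral of \<open>w\<close>, which is possible since \<open>w\<close> controls both its derivative and, through the
  bounds by \<open>D\<close>, its own boundary values.  A relative error lets estimates for successive
  frequencies be multiplied.
\<close>
lemma oscillating_integral_le:
  fixes w w' :: "real \<Rightarrow> real"
  assumes ab: "a < b" and n: "0 < n" and D: "0 < D"
    and w: "\<And>x. (w has_real_derivative w' x) (at x)"
    and L: "\<And>x. \<bar>w' x\<bar> \<le> L * w x" and wD: "\<And>x. 1 / D \<le> w x" "\<And>x. w x \<le> D"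
  shows "\<bar>integral {a..b} (\<lambda>x. w x * sin (n * x + \<theta>))\<bar>
           \<le> (2 * D\<^sup>2 / (b - a) + L) / n * integral {a..b} w"
proof -
  define F where "F x = - w x * cos (n * x + \<theta>) / n" for x
  let ?J = "integral {a..b} w"
  have cw: "continuous_on UNIV w"
    using w by (meson DERIV_isCont continuous_at_imp_continuous_on)
  have cs: "continuous_on UNIV (\<lambda>x. w x * sin (n * x + \<theta>))"
    using cw by (intro continuous_intros)
  have F: "((\<lambda>x. w x * sin (n * x + \<theta>) - w' x * cos (n * x + \<theta>) / n) has_integral F b - F a) {a..b}"
  proof (rule fundamental_theorem_of_calculus)
    fix x
    have "(F has_real_derivative w x * sin (n * x + \<theta>) - w' x * cos (n * x + \<theta>) / n) (at x)"
      unfolding F_def using n by (auto intro!: derivative_eq_intros w simp: field_simps)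
    then show "(F has_vector_derivative w x * sin (n * x + \<theta>) - w' x * cos (n * x + \<theta>) / n) (at x within {a..b})"
      using has_real_derivative_iff_has_vector_derivative has_vector_derivative_at_within by blast
  qed (use ab in auto)
  have iw: "w integrable_on {a..b}" and isn: "(\<lambda>x. w x * sin (n * x + \<theta>)) integrable_on {a..b}"
    using cw cs by auto
  have R: "((\<lambda>x. w' x * cos (n * x + \<theta>) / n) has_integral
        integral {a..b} (\<lambda>x. w x * sin (n * x + \<theta>)) - (F b - F a)) {a..b}"
    using has_integral_diff[OF integrable_integral[OF isn] F] by simp
  have "norm (integral {a..b} (\<lambda>x. w' x * cos (n * x + \<theta>) / n)) \<le> integral {a..b} (\<lambda>x. L / n * w x)"
  proof (rule integral_norm_bound_integral)
    show "(\<lambda>x. w' x * cos (n * x + \<theta>) / n) integrable_on {a..b}" using R by blast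
    show "(\<lambda>x. L / n * w x) integrable_on {a..b}" using iw by (intro integrable_on_mult_right)
    fix x
    have "\<bar>w' x * cos (n * x + \<theta>)\<bar> \<le> \<bar>w' x\<bar> * 1" unfolding abs_mult by (intro mult_left_mono) auto
    also have "\<dots> \<le> L * w x" using L by simp
    finally show "norm (w' x * cos (n * x + \<theta>) / n) \<le> L / n * w x"
      using n by (simp add: divide_right_mono)
  qed
  then have *: "\<bar>integral {a..b} (\<lambda>x. w x * sin (n * x + \<theta>)) - (F b - F a)\<bar> \<le> L / n * ?J"
    unfolding integral_unique[OF R] by simp
  have FD: "\<bar>F x\<bar> \<le> D / n" for x
  proof -
    have "w x \<ge> 0" using wD(1)[of x] D by (meson divide_nonneg_pos order_trans zero_le_one)
    then have "\<bar>w x * cos (n * x + \<theta>)\<bar> \<le> w x * 1"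
      unfolding abs_mult by (intro mult_mono) auto
    then show ?thesis using n wD(2)[of x] by (simp add: F_def divide_right_mono abs_mult)
  qed
  have "(b - a) / D = integral {a..b} (\<lambda>x. 1 / D)" using ab by simp
  also have "\<dots> \<le> ?J" using iw wD by (intro integral_le) auto
  finally have "D\<^sup>2 / (b - a) * ((b - a) / D) \<le> D\<^sup>2 / (b - a) * ?J"
    using ab by (intro mult_left_mono) auto
  then have "D \<le> D\<^sup>2 / (b - a) * ?J"
    using ab D by (simp add: power2_eq_square)
  then have "2 * D / n \<le> 2 * (D\<^sup>2 / (b - a) * ?J) / n" using n by (intro divide_right_mono) auto
  moreover have "\<bar>integral {a..b} (\<lambda>x. w x * sin (n * x + \<theta>))\<bar> \<le> 2 * D / n + L / n * ?J"
  proof -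
    have "2 * D / n = D / n + D / n" by simp
    with * FD[of a] FD[of b] show ?thesis by linarith
  qed
  moreover have "(2 * D\<^sup>2 / (b - a) + L) / n * ?J = 2 * (D\<^sup>2 / (b - a) * ?J) / n + L / n * ?J"
    by (simp add: add_divide_distrib distrib_right)
  ultimately show ?thesis by linarith
qed

section \<open>The Riesz product and its roots\<close>

text \<open>
  The total frequency \<open>L\<^sub>k\<close> is \<open>1\<close> plus the sum of the first \<open>k\<close> frequencies \<open>n\<^sub>j\<close>; it bounds the logarithmic
  derivative of the \<open>k\<close>-th partial product.  The scale \<open>r\<^sub>k\<close> is a length so short that the
  layers up to \<open>k\<close> hardly vary over it: their sum has Lipschitz constant at most \<open>2 ^ Suc k * L\<^sub>k\<close>,
  hence varies by at most \<open>(1/4) ^ Suc k\<close>.  The next frequency \<open>n\<^sub>k\<close> is so high that on intervals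
  of length at least \<open>r\<^sub>k\<close> the error in \<open>oscillating_integral_le\<close>, where \<open>D = 2 ^ k\<close>, is a
  fraction \<open>(1/2) ^ Suc k / B\<close> of the integral; this is where the powers of \<open>64\<close> come from.
\<close>
primrec total_freq :: "real \<Rightarrow> nat \<Rightarrow> real" where
  "total_freq B 0 = 1"
| "total_freq B (Suc k) = total_freq B k + B * 64 ^ Suc k * total_freq B k"

definition freq :: "real \<Rightarrow> nat \<Rightarrow> real" where
  "freq B k = B * 64 ^ Suc k * total_freq B k"

definition scale :: "real \<Rightarrow> nat \<Rightarrow> real" where
  "scale B k = 1 / (8 ^ Suc k * total_freq B k)"

definition riesz :: "real \<Rightarrow> nat \<Rightarrow> real \<Rightarrow> real" where
  "riesz B k x = (\<Prod>j<k. 1 + sin (freq B j * x) / 2)"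

lemma total_freq_ge_1:
  assumes "1 \<le> B" shows "1 \<le> total_freq B k"
  using assms by (induction k) (auto intro: add_increasing2)

lemma total_freq_mono:
  assumes "1 \<le> B" "j \<le> k" shows "total_freq B j \<le> total_freq B k"
proof (rule lift_Suc_mono_le[OF _ assms(2)])
  fix i have "0 \<le> B * 64 ^ Suc i * total_freq B i"
    using assms total_freq_ge_1[of B i] by (intro mult_nonneg_nonneg) auto
  then show "total_freq B i \<le> total_freq B (Suc i)" by simp
qed

lemma freq_pos: "1 \<le> B \<Longrightarrow> 0 < freq B k"
  using total_freq_ge_1[of B k] by (auto simp: freq_def)

lemma scale_pos: "1 \<le> B \<Longrightarrow> 0 < scale B k"
  using total_freq_ge_1[of B k] by (auto simp: scale_def)

lemma scale_antimono:
  assumes "1 \<le> B" "j \<le> k" shows "scale B k \<le> scale B j"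
  unfolding scale_def using assms total_freq_mono[OF assms] total_freq_ge_1[OF assms(1), of j]
  by (intro divide_left_mono mult_mono mult_pos_pos power_increasing) auto

lemma scale_le:
  assumes "1 \<le> B" shows "scale B k \<le> (1/8) ^ k"
proof -
  have "(8::real) ^ k * 1 \<le> 8 ^ Suc k * total_freq B k"
    using total_freq_ge_1[OF assms, of k] by (intro mult_mono) auto
  then have "1 / (8 ^ Suc k * total_freq B k) \<le> 1 / 8 ^ k" by (intro divide_left_mono) auto
  then show ?thesis by (simp add: scale_def power_one_over)
qed

lemma riesz_0 [simp]: "riesz B 0 x = 1"
  by (simp add: riesz_def)

lemma riesz_Suc: "riesz B (Suc k) x = riesz B k x * (1 + sin (freq B k * x) / 2)"
  by (simp add: riesz_def)

lemma riesz_factor_bounds: "1/2 \<le> 1 + sin y / (2::real)" "1 + sin y / (2::real) \<le> 2"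
  using sin_ge_minus_one[of y] sin_le_one[of y] by linarith+

lemma riesz_lower: "(1/2) ^ k \<le> riesz B k x"
proof (induction k)
  case (Suc k)
  have "(1/2) ^ k * (1/2) \<le> riesz B k x * (1 + sin (freq B k * x) / 2)"
    using Suc riesz_factor_bounds(1) by (intro mult_mono) (auto intro: order_trans[rotated])
  then show ?case by (simp add: riesz_Suc)
qed simp

lemma riesz_pos: "0 < riesz B k x"
  by (rule less_le_trans[OF _ riesz_lower]) simp

lemma riesz_upper: "riesz B k x \<le> 2 ^ k"
proof (induction k)
  case (Suc k)
  have "riesz B k x * (1 + sin (freq B k * x) / 2) \<le> 2 ^ k * 2"
    using Suc riesz_factor_bounds[of "freq B k * x"] by (intro mult_mono) auto
  then show ?case by (simp add: riesz_Suc)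
qed simp

text \<open>
  Each factor has logarithmic derivative at most its frequency, because
  \<open>\<bar>cos y\<bar> / 2 \<le> 1/2 \<le> 1 + sin y / 2\<close>.
\<close>
lemma riesz_has_derivative:
  assumes "1 \<le> B"
  obtains d where "\<And>x. (riesz B k has_real_derivative d x) (at x)"
    and "\<And>x. \<bar>d x\<bar> \<le> total_freq B k * riesz B k x"
proof (induction k arbitrary: thesis)
  case 0
  show ?case by (rule 0[of "\<lambda>x. 0"]) (auto simp: riesz_def)
next
  case (Suc k)
  obtain d where d: "\<And>x. (riesz B k has_real_derivative d x) (at x)"
    "\<And>x. \<bar>d x\<bar> \<le> total_freq B k * riesz B k x" using Suc.IH by blast
  define n where "n = freq B k"
  have n: "0 < n" using freq_pos[OF assms] by (simp add: n_def)
  define e where "e x = d x * (1 + sin (n * x) / 2) + riesz B k x * (n * cos (n * x) / 2)" for x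
  show ?case
  proof (rule Suc.prems)
    fix x
    have "((\<lambda>x. riesz B k x * (1 + sin (n * x) / 2)) has_real_derivative e x) (at x)"
      unfolding e_def by (auto intro!: derivative_eq_intros d simp: algebra_simps)
    then show "(riesz B (Suc k) has_real_derivative e x) (at x)"
      by (simp add: riesz_Suc[abs_def] n_def)
    have 1: "\<bar>d x * (1 + sin (n * x) / 2)\<bar> \<le> total_freq B k * riesz B k x * (1 + sin (n * x) / 2)"
      unfolding abs_mult using d riesz_factor_bounds[of "n * x"] order_trans[OF abs_ge_zero d(2)[of x]]
      by (intro mult_mono) auto
    have "\<bar>n * cos (n * x) / 2\<bar> \<le> n * (1 / 2)"
      using n by (simp add: abs_mult)
    also have "\<dots> \<le> n * (1 + sin (n * x) / 2)"
      using n riesz_factor_bounds[of "n * x"] by (intro mult_left_mono) auto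
    finally have 2: "\<bar>riesz B k x * (n * cos (n * x) / 2)\<bar> \<le> riesz B k x * (n * (1 + sin (n * x) / 2))"
      unfolding abs_mult using riesz_pos[of B k x] by (intro mult_mono) auto
    show "\<bar>e x\<bar> \<le> total_freq B (Suc k) * riesz B (Suc k) x"
      (is "_ \<le> ?R")
    proof -
      have "total_freq B (Suc k) = total_freq B k + n" by (simp add: n_def freq_def)
      then have "?R = total_freq B k * riesz B k x * (1 + sin (n * x) / 2)
          + riesz B k x * (n * (1 + sin (n * x) / 2))"
        unfolding riesz_Suc n_def[symmetric] by (simp add: distrib_left distrib_right)
      with 1 2 show ?thesis unfolding e_def by linarith
    qed
  qed
qed

lemma continuous_riesz: "continuous_on UNIV (riesz B k)"
  unfolding riesz_def[abs_def] by (intro continuous_intros) auto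

lemma freq_error_le:
  assumes B: "1 \<le> B" and r: "scale B k \<le> r"
  shows "(2 * (2 ^ k)\<^sup>2 / r + total_freq B k) / freq B k \<le> (1/2) ^ Suc k / B"
proof -
  let ?L = "total_freq B k"
  have L: "1 \<le> ?L" using total_freq_ge_1[OF B] .
  have r0: "0 < r" using scale_pos[OF B, of k] r by linarith
  have "2 * (2 ^ k)\<^sup>2 / r \<le> 2 * (2 ^ k)\<^sup>2 / scale B k"
    using r scale_pos[OF B, of k] r0 by (intro divide_left_mono) auto
  also have "\<dots> = 16 * 32 ^ k * ?L"
    by (simp add: scale_def power2_eq_square flip: power_mult_distrib)
  finally have "2 * (2 ^ k)\<^sup>2 / r + ?L \<le> 16 * 32 ^ k * ?L + 32 ^ k * ?L"
    using L by (intro add_mono) auto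
  also have "\<dots> \<le> 32 ^ Suc k * ?L" using L by simp
  finally have "(2 * (2 ^ k)\<^sup>2 / r + ?L) / freq B k \<le> 32 ^ Suc k * ?L / freq B k"
    using freq_pos[OF B, of k] by (intro divide_right_mono) auto
  also have "\<dots> = (32 / 64) ^ Suc k / B"
    unfolding freq_def power_divide using L B by simp
  finally show ?thesis by simp
qed

lemma riesz_oscillation:
  assumes B: "1 \<le> B" and ab: "a < b" "scale B k \<le> b - a"
  shows "\<bar>integral {a..b} (\<lambda>x. riesz B k x * sin (freq B k * x))\<bar>
           \<le> (1/2) ^ Suc k * integral {a..b} (riesz B k)"
proof -
  obtain d where d: "\<And>x. (riesz B k has_real_derivative d x) (at x)"
    "\<And>x. \<bar>d x\<bar> \<le> total_freq B k * riesz B k x" using riesz_has_derivative[OF B, of k] by metis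
  have J: "0 \<le> integral {a..b} (riesz B k)"
    using continuous_riesz by (auto intro!: integral_nonneg less_imp_le[OF riesz_pos])
  have "\<bar>integral {a..b} (\<lambda>x. riesz B k x * sin (freq B k * x + 0))\<bar>
          \<le> (2 * (2 ^ k)\<^sup>2 / (b - a) + total_freq B k) / freq B k * integral {a..b} (riesz B k)"
    using riesz_lower[of k B] riesz_upper[of B k]
    by (intro oscillating_integral_le[OF ab(1) freq_pos[OF B] _ d]) (auto simp: power_one_over)
  also have "\<dots> \<le> (1/2) ^ Suc k / B * integral {a..b} (riesz B k)"
    by (intro mult_right_mono freq_error_le[OF B] ab J)
  also have "\<dots> \<le> (1/2) ^ Suc k / 1 * integral {a..b} (riesz B k)"
    using B J by (intro mult_right_mono divide_left_mono) auto
  finally show ?thesis by simp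
qed

lemma riesz_integral_Suc:
  assumes B: "1 \<le> B" and ab: "a < b" "scale B k \<le> b - a"
  shows "\<bar>integral {a..b} (riesz B (Suc k)) - integral {a..b} (riesz B k)\<bar>
           \<le> (1/2) ^ (k + 2) * integral {a..b} (riesz B k)"
proof -
  have c: "continuous_on UNIV (\<lambda>x. riesz B k x * sin (freq B k * x))"
    using continuous_riesz by (intro continuous_intros)
  have "integral {a..b} (riesz B (Suc k))
      = integral {a..b} (\<lambda>x. riesz B k x + riesz B k x * sin (freq B k * x) * (1/2))"
    by (simp add: riesz_Suc[abs_def] algebra_simps)
  also have "\<dots> = integral {a..b} (riesz B k)
      + integral {a..b} (\<lambda>x. riesz B k x * sin (freq B k * x)) * (1/2)"
    using c continuous_riesz by (subst integral_add) (auto intro!: integrable_on_mult_left)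
  finally show ?thesis using riesz_oscillation[OF assms] by simp
qed

text \<open>
  The step from \<open>j\<close> to \<open>Suc j\<close> changes the integral by a factor between \<open>1 - (1/2) ^ j / 4\<close> and
  \<open>1 + (1/2) ^ j / 4\<close>.  To keep the product of all these factors between \<open>1/2\<close> and \<open>2\<close>, the
  integrals are multiplied by \<open>2 - (1/2) ^ j\<close> and by \<open>1 + (1/2) ^ j\<close>; the resulting
  sequences are monotone.
\<close>
lemma riesz_integral_comparable:
  assumes B: "1 \<le> B" and ab: "a < b" "scale B k \<le> b - a" and kN: "k \<le> N"
  shows "integral {a..b} (riesz B k) \<le> 2 * integral {a..b} (riesz B N)"
    and "integral {a..b} (riesz B N) \<le> 2 * integral {a..b} (riesz B k)"
proof -
  define J where "J j = integral {a..b} (riesz B j)" for j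
  have J: "0 \<le> J j" for j
    unfolding J_def using continuous_riesz by (auto intro!: integral_nonneg less_imp_le[OF riesz_pos])
  have incr: "(1 - (1/2) ^ j / 4) * J j \<le> J (Suc j)" "J (Suc j) \<le> (1 + (1/2) ^ j / 4) * J j"
    if "k \<le> j" for j
  proof -
    have "\<bar>J (Suc j) - J j\<bar> \<le> (1/2) ^ j / 4 * J j"
      using riesz_integral_Suc[OF B ab(1), of j] scale_antimono[OF B that] ab(2)
      unfolding J_def by (simp add: power_add)
    then show "(1 - (1/2) ^ j / 4) * J j \<le> J (Suc j)" "J (Suc j) \<le> (1 + (1/2) ^ j / 4) * J j"
      unfolding left_diff_distrib distrib_right by linarith+
  qed
  have x: "0 \<le> (1/2::real) ^ j" "(1/2::real) ^ j \<le> 1" for j :: nat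
    by (auto simp: power_le_one)
  have lo: "(2 - (1/2) ^ k) * J k \<le> (2 - (1/2) ^ N) * J N" using kN
  proof (induction rule: dec_induct)
    case (step j)
    let ?x = "(1/2::real) ^ j"
    have "(2 - ?x) * J j \<le> (2 - ?x/2) * ((1 - ?x/4) * J j)"
    proof -
      have "2 - ?x \<le> (2 - ?x/2) * (1 - ?x/4)" using x[of j] by (simp add: algebra_simps)
      from mult_right_mono[OF this J] show ?thesis by (simp add: mult.assoc)
    qed
    also have "\<dots> \<le> (2 - ?x/2) * J (Suc j)"
      using incr(1)[OF step.hyps(1)] x[of j] by (intro mult_left_mono) auto
    finally show ?case using step.IH by simp
  qed simp
  have "1 * J k \<le> (2 - (1/2) ^ k) * J k" using x[of k] J by (intro mult_right_mono) auto
  also note lo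
  also have "(2 - (1/2) ^ N) * J N \<le> 2 * J N" using x[of N] J by (intro mult_right_mono) auto
  finally show "integral {a..b} (riesz B k) \<le> 2 * integral {a..b} (riesz B N)" by (simp add: J_def)
  have hi: "(1 + (1/2) ^ N) * J N \<le> (1 + (1/2) ^ k) * J k" using kN
  proof (induction rule: dec_induct)
    case (step j)
    let ?x = "(1/2::real) ^ j"
    have "(1 + ?x/2) * J (Suc j) \<le> (1 + ?x/2) * ((1 + ?x/4) * J j)"
      using incr(2)[OF step.hyps(1)] x[of j] by (intro mult_left_mono) auto
    also have "\<dots> \<le> (1 + ?x) * J j"
    proof -
      have "?x * ?x \<le> ?x" using x[of j] by (intro mult_left_le) auto
      moreover have "(1 + ?x/2) * (1 + ?x/4) = 1 + 3 / 4 * ?x + ?x * ?x / 8"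
        by (simp add: algebra_simps)
      ultimately have "(1 + ?x/2) * (1 + ?x/4) \<le> 1 + ?x" using x(1)[of j] by linarith
      from mult_right_mono[OF this J] show ?thesis by (simp add: mult.assoc)
    qed
    finally show ?case using step.IH by simp
  qed simp
  have "1 * J N \<le> (1 + (1/2) ^ N) * J N" using x[of N] J by (intro mult_right_mono) auto
  also note hi
  also have "(1 + (1/2) ^ k) * J k \<le> 2 * J k" using x[of k] J by (intro mult_right_mono) auto
  finally show "integral {a..b} (riesz B N) \<le> 2 * integral {a..b} (riesz B k)" by (simp add: J_def)
qed

lemma riesz_root_has_derivative:
  assumes B: "1 \<le> B" and q: "0 < q" "q < 1"
  obtains d where "\<And>x. ((\<lambda>x. riesz B k x powr q) has_real_derivative d x) (at x)"
    and "\<And>x. \<bar>d x\<bar> \<le> total_freq B k * riesz B k x powr q"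
proof -
  obtain d where d: "\<And>x. (riesz B k has_real_derivative d x) (at x)"
    "\<And>x. \<bar>d x\<bar> \<le> total_freq B k * riesz B k x" using riesz_has_derivative[OF B, of k] by metis
  show ?thesis
  proof
    fix x
    let ?v = "riesz B k x"
    show "((\<lambda>x. riesz B k x powr q) has_real_derivative q * ?v powr (q - 1) * d x) (at x)"
      using riesz_pos[of B k x] by (auto intro!: derivative_eq_intros d)
    have "\<bar>q * ?v powr (q - 1) * d x\<bar> = q * (?v powr (q - 1) * \<bar>d x\<bar>)"
      using q by (simp add: abs_mult)
    also have "\<dots> \<le> 1 * (?v powr (q - 1) * (total_freq B k * ?v))"
      using q d by (intro mult_mono) auto
    also have "\<dots> = total_freq B k * (?v * ?v powr (q - 1))" by simp
    also have "?v * ?v powr (q - 1) = ?v powr q"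
      using powr_mult_base[of ?v "q - 1"] riesz_pos[of B k x] by simp
    finally show "\<bar>q * ?v powr (q - 1) * d x\<bar> \<le> total_freq B k * ?v powr q" .
  qed
qed

lemma continuous_riesz_root: "continuous_on UNIV (\<lambda>x. riesz B k x powr q)"
  using continuous_riesz[of B k] riesz_pos[of B k]
  by (intro continuous_intros) (auto simp: less_imp_neq[symmetric])

lemma riesz_root_lower:
  assumes "0 < q" "q < 1" shows "(1/2) ^ k \<le> riesz B k x powr q"
proof -
  have "(1/2::real) ^ k = ((1/2) ^ k) powr 1" by simp
  also have "\<dots> \<le> ((1/2) ^ k) powr q"
    using assms by (intro powr_mono') (auto simp: power_le_one)
  also have "\<dots> \<le> riesz B k x powr q" using assms riesz_lower by (intro powr_mono2) auto
  finally show ?thesis .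
qed

lemma riesz_root_upper:
  assumes "0 < q" "q < 1" shows "riesz B k x powr q \<le> 2 ^ k"
proof -
  have "riesz B k x powr q \<le> (2 ^ k) powr q"
    using assms riesz_upper less_imp_le[OF riesz_pos] by (intro powr_mono2) auto
  also have "\<dots> \<le> (2 ^ k) powr 1" using assms by (intro powr_mono) auto
  finally show ?thesis by simp
qed

text \<open>
  With \<open>s = sin (n x)\<close>, the bound \<open>powr_le_quadratic\<close> and \<open>s\<^sup>2 = (1 - cos (2 n x)) / 2\<close>
  give \<open>(1 + s / 2) powr q \<le> (1 - c / 8) + q / 2 * s + c / 8 * cos (2 n x)\<close>.  The two oscillating
  terms contribute little, and the choice \<open>B = 8 / c\<close> makes their contribution at most half of
  the gain \<open>c / 8\<close>.
\<close>
lemma riesz_root_integral_Suc: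
  fixes q :: real
  defines "c \<equiv> q * (1 - q) / 8"
  assumes q: "0 < q" "q < 1" and B: "B = 8 / c" and ab: "a < b" "scale B k \<le> b - a"
  shows "integral {a..b} (\<lambda>x. riesz B (Suc k) x powr q)
           \<le> (1 - c / 16) * integral {a..b} (\<lambda>x. riesz B k x powr q)"
proof -
  have c: "0 < c" "c \<le> 1"
    using q mult_mono[of q 1 "1 - q" 1] by (auto simp: c_def)
  have B1: "1 \<le> B" using c by (simp add: B)
  define u where "u x = riesz B k x powr q" for x
  define n where "n = freq B k"
  define J where "J = integral {a..b} u"
  have cu: "continuous_on UNIV u" unfolding u_def by (rule continuous_riesz_root)
  have J: "0 \<le> J" unfolding J_def using cu by (auto intro!: integral_nonneg simp: u_def)
  obtain d where d: "\<And>x. (u has_real_derivative d x) (at x)"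
    "\<And>x. \<bar>d x\<bar> \<le> total_freq B k * u x"
    using riesz_root_has_derivative[OF B1 q] unfolding u_def by blast
  have n: "0 < n" using freq_pos[OF B1] by (simp add: n_def)
  have osc: "\<bar>integral {a..b} (\<lambda>x. u x * sin (m * x + \<theta>))\<bar> \<le> c / 16 * J" if m: "n \<le> m" for m \<theta>
  proof -
    let ?E = "2 * (2 ^ k)\<^sup>2 / (b - a) + total_freq B k"
    have E: "0 \<le> ?E" using ab total_freq_ge_1[OF B1, of k] by auto
    have "\<bar>integral {a..b} (\<lambda>x. u x * sin (m * x + \<theta>))\<bar> \<le> ?E / m * J"
      unfolding J_def using riesz_root_lower[OF q, of k B] riesz_root_upper[OF q, of B k] n m
      by (intro oscillating_integral_le[OF ab(1) _ _ d]) (auto simp: power_one_over u_def)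
    also have "\<dots> \<le> ?E / n * J"
      using n m E J by (intro mult_right_mono divide_left_mono) auto
    also have "\<dots> \<le> (1/2) ^ Suc k / B * J"
      using freq_error_le[OF B1 ab(2)] J by (intro mult_right_mono) (auto simp: n_def)
    also have "(1/2) ^ Suc k / B = (1/2) ^ k * (c / 16)" by (simp add: B)
    also have "\<dots> \<le> 1 * (c / 16)" using c by (intro mult_right_mono) (auto simp: power_le_one)
    finally show ?thesis using J by (simp add: mult_right_mono)
  qed
  have ptw: "riesz B (Suc k) x powr q
     \<le> (1 - c / 8) * u x + q / 2 * (u x * sin (n * x + 0)) + c / 8 * (u x * sin (2 * n * x + pi / 2))" for x
  proof -
    let ?s = "sin (n * x)"
    have s: "\<bar>?s / 2\<bar> \<le> 1/2" by simp
    have "riesz B (Suc k) x powr q = u x * (1 + ?s / 2) powr q"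
      using riesz_pos[of B k x] riesz_factor_bounds[of "n * x"]
      by (simp add: riesz_Suc u_def n_def powr_mult)
    also have "\<dots> \<le> u x * (1 + q * (?s / 2) - c * (?s / 2)\<^sup>2)"
      using powr_le_quadratic[OF q s] by (intro mult_left_mono) (auto simp: u_def c_def)
    also have "sin (2 * n * x + pi / 2) = 1 - 2 * ?s\<^sup>2"
      using cos_double_sin[of "n * x"] by (simp add: sin_add mult.assoc)
    then have "u x * (1 + q * (?s / 2) - c * (?s / 2)\<^sup>2) =
      (1 - c / 8) * u x + q / 2 * (u x * sin (n * x + 0)) + c / 8 * (u x * sin (2 * n * x + pi / 2))"
      by (simp only:) (simp add: algebra_simps power2_eq_square)
    finally show ?thesis .
  qed
  have c1: "continuous_on UNIV (\<lambda>x. u x * sin (n * x + 0))"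
    and c2: "continuous_on UNIV (\<lambda>x. u x * sin (2 * n * x + pi / 2))"
    using cu by (auto intro!: continuous_intros)
  have i: "(\<lambda>x. (1 - c / 8) * u x) integrable_on {a..b}"
      "(\<lambda>x. q / 2 * (u x * sin (n * x + 0))) integrable_on {a..b}"
      "(\<lambda>x. c / 8 * (u x * sin (2 * n * x + pi / 2))) integrable_on {a..b}"
    by (intro integrable_on_mult_right continuous_imp_integrable_on_interval cu c1 c2)+
  have "integral {a..b} (\<lambda>x. riesz B (Suc k) x powr q)
    \<le> integral {a..b} (\<lambda>x. (1 - c / 8) * u x + q / 2 * (u x * sin (n * x + 0))
         + c / 8 * (u x * sin (2 * n * x + pi / 2)))"
    by (intro integral_le integrable_add i ptw continuous_imp_integrable_on_interval continuous_riesz_root)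
  also have "\<dots> = (1 - c / 8) * J + q / 2 * integral {a..b} (\<lambda>x. u x * sin (n * x + 0))
      + c / 8 * integral {a..b} (\<lambda>x. u x * sin (2 * n * x + pi / 2))"
    unfolding J_def by (subst integral_add integral_mult_right; (intro integrable_add i)?)+ simp
  also have "\<dots> \<le> (1 - c / 8) * J + q / 2 * (c / 16 * J) + c / 8 * (c / 16 * J)"
    using osc[of n 0] osc[of "2 * n" "pi / 2"] q c n
    by (intro add_mono mult_left_mono) auto
  also have "\<dots> = (1 - c / 8 + (q / 2 + c / 8) * (c / 16)) * J" by (simp add: algebra_simps)
  also have "\<dots> \<le> (1 - c / 8 + 1 * (c / 16)) * J"
    using q c J by (intro mult_right_mono add_left_mono) auto
  finally show ?thesis by (simp add: J_def u_def[abs_def])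
qed

section \<open>Integrals and mean oscillations over intervals\<close>

text \<open>
  Integrals of continuous functions over an arbitrary bounded interval are integrals between
  its endpoints, where the fundamental theorem of calculus applies.
\<close>
lemma bounded_interval_endpoints:
  assumes "bounded_interval Q"
  obtains a b :: real where "a < b" "measure lebesgue Q = b - a" "Q \<subseteq> {a..b}" "Q \<in> lmeasurable"
    "\<And>f::real \<Rightarrow> real. continuous_on UNIV f \<Longrightarrow> set_integrable lebesgue Q f"
    "\<And>f::real \<Rightarrow> real. continuous_on UNIV f \<Longrightarrow> (LINT x:Q|lebesgue. f x) = integral {a..b} f"
proof -
  have Q: "is_interval Q" "bounded Q" "0 < measure lebesgue Q"
    using assms by (auto simp: bounded_interval_def)
  have ne: "Q \<noteq> {}" using Q(3) by auto
  define a b where "a = Inf Q" and "b = Sup Q"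
  have bdd: "bdd_above Q" "bdd_below Q" using Q(2) by (simp_all add: bounded_imp_bdd_above bounded_imp_bdd_below)
  have sub: "Q \<subseteq> {a..b}"
    using bdd by (auto simp: a_def b_def intro: cInf_lower cSup_upper)
  have sup: "{a<..<b} \<subseteq> Q"
  proof
    fix x assume x: "x \<in> {a<..<b}"
    then obtain y z where "y \<in> Q" "y < x" "z \<in> Q" "x < z"
      using cInf_less_iff[OF ne bdd(2)] less_cSup_iff[OF ne bdd(1)] by (auto simp: a_def b_def)
    then show "x \<in> Q" using Q(1) unfolding is_interval_1 by (meson less_imp_le)
  qed
  have diff: "{a..b} - Q \<subseteq> {a, b}" using sup by force
  have lm: "Q \<in> lmeasurable" using Q by (intro measurable_convex) (auto simp: is_interval_convex)
  have neg: "negligible {x \<in> {a..b} - Q. P x}" "negligible {x \<in> Q - {a..b}. P x}" for P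
    by (rule negligible_subset[of "{a, b}"]; use diff sub in auto)+
  have "measure lebesgue Q = measure lebesgue {a..b}"
  proof (rule measure_negligible_symdiff)
    show "{a..b} \<in> lmeasurable" by simp
    show "negligible ({a..b} - Q \<union> (Q - {a..b}))"
      by (rule negligible_subset[of "{a, b}"]) (use diff sub in auto)
  qed
  moreover from this have "a < b"
    using Q(3) by (cases "a \<le> b") (auto simp: le_less)
  ultimately have m: "measure lebesgue Q = b - a" "a < b" by simp_all
  have int: "set_integrable lebesgue Q f" if "continuous_on UNIV f" for f :: "real \<Rightarrow> real"
    by (rule absolutely_integrable_spike_set[where S = "{a..b}",
          OF absolutely_integrable_continuous_real[OF continuous_on_subset[OF that]]])
      (simp_all only: neg subset_UNIV)
  show ?thesis
  proof (rule that[OF m(2,1) sub lm int])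
    fix f :: "real \<Rightarrow> real" assume f: "continuous_on UNIV f"
    have "(LINT x:Q|lebesgue. f x) = integral Q f"
      by (rule set_lebesgue_integral_eq_integral(2)[OF int[OF f]])
    also have "\<dots> = integral {a..b} f" using neg by (intro integral_spike_set)
    finally show "(LINT x:Q|lebesgue. f x) = integral {a..b} f" .
  qed
qed

lemma interval_const:
  fixes z :: real
  assumes "bounded_interval Q"
  shows "set_integrable lebesgue Q (\<lambda>x. z)" "(LINT x:Q|lebesgue. z) = measure lebesgue Q * z"
proof -
  obtain a b where ab: "a < b" "measure lebesgue Q = b - a"
    "\<And>f::real \<Rightarrow> real. continuous_on UNIV f \<Longrightarrow> set_integrable lebesgue Q f"
    "\<And>f::real \<Rightarrow> real. continuous_on UNIV f \<Longrightarrow> (LINT x:Q|lebesgue. f x) = integral {a..b} f"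
    using bounded_interval_endpoints[OF assms] by metis
  show "set_integrable lebesgue Q (\<lambda>x. z)" by (intro ab(3)) auto
  show "(LINT x:Q|lebesgue. z) = measure lebesgue Q * z" using ab(1,2) ab(4)[of "\<lambda>x. z"] by simp
qed

lemma mean_osc_le:
  assumes Q: "bounded_interval Q" and h: "set_integrable lebesgue Q h"
  shows "mean_osc Q h \<le> 2 * avg Q (\<lambda>x. \<bar>h x - y\<bar>)"
proof -
  let ?m = "measure lebesgue Q"
  have m: "0 < ?m" using Q by (simp add: bounded_interval_def)
  have const: "set_integrable lebesgue Q (\<lambda>x. z)" "(LINT x:Q|lebesgue. z) = ?m * z" for z :: real
    by (rule interval_const[OF Q])+
  have d: "set_integrable lebesgue Q (\<lambda>x. \<bar>h x - z\<bar>)" for z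
    by (intro set_integrable_abs set_integral_diff h const)
  have "avg Q h - y = (1 / ?m) * (LINT x:Q|lebesgue. h x - y)"
    using m by (simp add: avg_def set_integral_diff(2)[OF h const(1)] const field_simps)
  then have "\<bar>avg Q h - y\<bar> = (1 / ?m) * \<bar>LINT x:Q|lebesgue. h x - y\<bar>"
    using m by (simp add: abs_mult)
  also have "\<dots> \<le> avg Q (\<lambda>x. \<bar>h x - y\<bar>)"
    unfolding avg_def using m set_integral_norm_bound[OF set_integral_diff(1)[OF h const(1)], of y]
    by (intro mult_left_mono) auto
  finally have 1: "\<bar>avg Q h - y\<bar> \<le> avg Q (\<lambda>x. \<bar>h x - y\<bar>)" .
  have "mean_osc Q h \<le> (1 / ?m) * (LINT x:Q|lebesgue. \<bar>h x - y\<bar> + \<bar>avg Q h - y\<bar>)"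
    unfolding mean_osc_def avg_def[of Q "\<lambda>x. \<bar>h x - avg Q h\<bar>"] using m
    by (intro mult_left_mono set_integral_mono set_integral_add d const) auto
  also have "\<dots> = avg Q (\<lambda>x. \<bar>h x - y\<bar>) + \<bar>avg Q h - y\<bar>"
    unfolding set_integral_add(2)[OF d const(1)] const avg_def[of Q "\<lambda>x. \<bar>h x - y\<bar>"]
    using m by (simp add: distrib_left)
  finally show ?thesis using 1 by simp
qed

lemma AE_summable_of_summable_integrals:
  fixes h :: "nat \<Rightarrow> 'a \<Rightarrow> real"
  assumes int: "\<And>k. integrable M (h k)" and pos: "\<And>k x. 0 \<le> h k x"
    and sum: "summable (\<lambda>k. \<integral>x. h k x \<partial>M)"
  shows "AE x in M. summable (\<lambda>k. h k x)"
proof -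
  have [measurable]: "h k \<in> borel_measurable M" for k using int by auto
  have "(\<integral>\<^sup>+x. (\<Sum>k. ennreal (h k x)) \<partial>M) = (\<Sum>k. ennreal (\<integral>x. h k x \<partial>M))"
    using int pos by (simp add: nn_integral_suminf nn_integral_eq_integral)
  also have "\<dots> = ennreal (\<Sum>k. \<integral>x. h k x \<partial>M)"
    using pos sum by (intro suminf_ennreal2) auto
  finally have "(\<integral>\<^sup>+x. (\<Sum>k. ennreal (h k x)) \<partial>M) \<noteq> \<infinity>" by simp
  then have "AE x in M. (\<Sum>k. ennreal (h k x)) \<noteq> \<infinity>" by (intro nn_integral_PInf_AE) auto
  then show ?thesis by eventually_elim (use pos in \<open>auto intro: summable_suminf_not_top\<close>)
qed

lemma set_integral_suminf_nonneg:
  fixes h :: "nat \<Rightarrow> 'a \<Rightarrow> real"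
  assumes int: "\<And>k. set_integrable M Q (h k)" and pos: "\<And>k x. 0 \<le> h k x"
    and sum: "summable (\<lambda>k. LINT x:Q|M. h k x)"
  shows "AE x in M. x \<in> Q \<longrightarrow> summable (\<lambda>k. h k x)"
    and "set_integrable M Q (\<lambda>x. \<Sum>k. h k x)"
    and "(LINT x:Q|M. (\<Sum>k. h k x)) = (\<Sum>k. LINT x:Q|M. h k x)"
proof -
  define f where "f k x = indicator Q x * h k x" for k x
  have f: "integrable M (f k)" "0 \<le> f k x" "(LINT x:Q|M. h k x) = (\<integral>x. f k x \<partial>M)" for k x
    using int[of k] pos by (auto simp: f_def[abs_def] set_integrable_def set_lebesgue_integral_def)
  have ae: "AE x in M. summable (\<lambda>k. f k x)"
    using f(1,2) sum unfolding f(3) by (rule AE_summable_of_summable_integrals)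
  show "AE x in M. x \<in> Q \<longrightarrow> summable (\<lambda>k. h k x)"
    using ae by eventually_elim (auto simp: f_def)
  have eq: "indicator Q x * (\<Sum>k. h k x) = (\<Sum>k. f k x)" for x
    by (auto simp: f_def indicator_def)
  have ae': "AE x in M. summable (\<lambda>k. norm (f k x))"
    and sum': "summable (\<lambda>k. \<integral>x. norm (f k x) \<partial>M)"
    using ae f(2) sum unfolding f(3) by simp_all
  show "set_integrable M Q (\<lambda>x. \<Sum>k. h k x)"
    using integrable_suminf[OF f(1) ae' sum'] by (simp add: set_integrable_def eq)
  show "(LINT x:Q|M. (\<Sum>k. h k x)) = (\<Sum>k. LINT x:Q|M. h k x)"
    using integral_suminf[OF f(1) ae' sum'] by (simp add: set_lebesgue_integral_def[of M Q "\<lambda>x. \<Sum>k. h k x"] eq f(3))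
qed

text \<open>
  The partial sum of the first \<open>k\<close> terms is within \<open>\<omega>\<close> of its value at any point of \<open>Q\<close>; the rest
  is nonnegative, so that its mean oscillation is at most twice its average.  The sum need only converge
  almost everywhere: where it diverges, \<open>\<Sum>j. H j x\<close> is an unspecified number.
\<close>
lemma mean_osc_suminf_le:
  fixes H :: "nat \<Rightarrow> real \<Rightarrow> real"
  assumes Q: "bounded_interval Q" and int: "\<And>j. set_integrable lebesgue Q (H j)"
    and pos: "\<And>j x. 0 \<le> H j x" and sum: "summable (\<lambda>j. LINT x:Q|lebesgue. H j x)"
    and osc: "\<And>x y. x \<in> Q \<Longrightarrow> y \<in> Q \<Longrightarrow> \<bar>(\<Sum>j<k. H j x) - (\<Sum>j<k. H j y)\<bar> \<le> \<omega>"
  shows "mean_osc Q (\<lambda>x. \<Sum>j. H j x)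
           \<le> 2 * (\<omega> + (\<Sum>j. LINT x:Q|lebesgue. H (j + k) x) / measure lebesgue Q)"
proof -
  let ?m = "measure lebesgue Q"
  have m: "0 < ?m" using Q by (simp add: bounded_interval_def)
  obtain x0 where x0: "x0 \<in> Q" using m by fastforce
  define y where "y = (\<Sum>j<k. H j x0)"
  define T where "T x = (\<Sum>j. H (j + k) x)" for x
  note S = set_integral_suminf_nonneg[OF int pos sum]
  have sumk: "summable (\<lambda>j. LINT x:Q|lebesgue. H (j + k) x)"
    using sum by (subst summable_iff_shift)
  note Sk = set_integral_suminf_nonneg[of lebesgue Q "\<lambda>j. H (j + k)", OF int pos sumk, folded T_def]
  have const: "set_integrable lebesgue Q (\<lambda>x. z)" "(LINT x:Q|lebesgue. z) = ?m * z" for z :: real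
    by (rule interval_const[OF Q])+
  have "(LINT x:Q|lebesgue. \<bar>(\<Sum>j. H j x) - y\<bar>) \<le> (LINT x:Q|lebesgue. \<omega> + T x)"
  proof (rule set_integral_mono_AE)
    show "AE x\<in>Q in lebesgue. \<bar>(\<Sum>j. H j x) - y\<bar> \<le> \<omega> + T x"
      using S(1)
    proof eventually_elim
      case (elim x)
      show ?case
      proof
        assume x: "x \<in> Q"
        then have s: "summable (\<lambda>j. H j x)" using elim by simp
        have "(\<Sum>j. H j x) = T x + (\<Sum>j<k. H j x)"
          unfolding T_def by (rule suminf_split_initial_segment[OF s])
        moreover have "0 \<le> T x"
          unfolding T_def using s pos by (intro suminf_nonneg summable_ignore_initial_segment)
        ultimately show "\<bar>(\<Sum>j. H j x) - y\<bar> \<le> \<omega> + T x"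
          using osc[OF x x0] by (simp add: y_def abs_le_iff)
      qed
    qed
  qed (intro set_integrable_abs set_integral_diff set_integral_add S Sk const)+
  also have "\<dots> = ?m * \<omega> + (\<Sum>j. LINT x:Q|lebesgue. H (j + k) x)"
    by (simp add: set_integral_add(2)[OF const(1) Sk(2)] const Sk(3))
  finally have "avg Q (\<lambda>x. \<bar>(\<Sum>j. H j x) - y\<bar>) \<le> (1 / ?m) * (?m * \<omega> + (\<Sum>j. LINT x:Q|lebesgue. H (j + k) x))"
    unfolding avg_def using m by (intro mult_left_mono) auto
  also have "\<dots> = \<omega> + (\<Sum>j. LINT x:Q|lebesgue. H (j + k) x) / ?m" using m by (simp add: field_simps)
  finally show ?thesis using mean_osc_le[OF Q S(2), of y] by simp
qed

section \<open>The function\<close>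

text \<open>
  With \<open>q = 1 / p\<close> the weights tend to \<open>0\<close>, as \<open>VJN\<close> requires, while their \<open>p\<close>-th powers form the
  harmonic series.
\<close>
definition weight :: "real \<Rightarrow> nat \<Rightarrow> real" where
  "weight q k = real (Suc k) powr (- q)"

definition layer :: "real \<Rightarrow> real \<Rightarrow> nat \<Rightarrow> real \<Rightarrow> real" where
  "layer q B k x = weight q k * riesz B k x powr q"

lemma weight_pos: "0 < weight q k"
  by (simp add: weight_def)

lemma weight_antimono:
  assumes "0 < q" "j \<le> k" shows "weight q k \<le> weight q j"
  unfolding weight_def using assms by (intro powr_mono2') auto

lemma weight_le_1: "0 < q \<Longrightarrow> weight q k \<le> 1"
  using weight_antimono[of q 0 k] by (simp add: weight_def)

lemma weight_ge:
  assumes "0 < q" "q < 1" shows "(1/2) ^ k \<le> weight q k"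
proof -
  have "real (Suc k) \<le> 2 ^ k" by (induction k) auto
  then have "1 / 2 ^ k \<le> 1 / real (Suc k)" by (intro divide_left_mono) auto
  also have "\<dots> = real (Suc k) powr (-1)" by (simp add: powr_minus divide_inverse)
  also have "\<dots> \<le> weight q k" unfolding weight_def using assms by (intro powr_mono) auto
  finally show ?thesis by (simp add: power_one_over)
qed

lemma weight_powr:
  assumes "0 < p" shows "weight (1 / p) k powr p = 1 / real (Suc k)"
proof -
  have "weight (1 / p) k powr p = real (Suc k) powr (-1)"
    using assms by (simp add: weight_def powr_powr del: of_nat_Suc)
  then show ?thesis by (simp add: powr_minus divide_inverse)
qed

lemma layer_nonneg: "0 \<le> layer q B k x"
  by (simp add: layer_def less_imp_le[OF weight_pos])

lemma continuous_layer: "continuous_on UNIV (layer q B k)"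
  unfolding layer_def[abs_def] by (intro continuous_intros continuous_riesz_root)

lemma layer_lipschitz:
  assumes B: "1 \<le> B" and q: "0 < q" "q < 1"
  shows "\<bar>layer q B k x - layer q B k y\<bar> \<le> total_freq B k * 2 ^ k * \<bar>x - y\<bar>"
proof -
  obtain d where d: "\<And>x. ((\<lambda>x. riesz B k x powr q) has_real_derivative d x) (at x)"
    "\<And>x. \<bar>d x\<bar> \<le> total_freq B k * riesz B k x powr q"
    using riesz_root_has_derivative[OF B q, of k] by metis
  have "norm (layer q B k x - layer q B k y) \<le> total_freq B k * 2 ^ k * norm (x - y)"
  proof (rule field_differentiable_bound[where S = UNIV and f' = "\<lambda>x. weight q k * d x"])
    fix z
    show "(layer q B k has_field_derivative weight q k * d z) (at z within UNIV)"
      unfolding layer_def[abs_def] by (intro DERIV_cmult d)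
    have "norm (weight q k * d z) = weight q k * \<bar>d z\<bar>"
      using weight_pos[of q k] by (simp add: abs_mult)
    also have "\<dots> \<le> 1 * \<bar>d z\<bar>" using weight_le_1[OF q(1)] by (intro mult_right_mono) auto
    also have "\<dots> \<le> total_freq B k * riesz B k z powr q" using d by simp
    also have "\<dots> \<le> total_freq B k * 2 ^ k"
      using riesz_root_upper[OF q] total_freq_ge_1[OF B, of k] by (intro mult_left_mono) auto
    finally show "norm (weight q k * d z) \<le> total_freq B k * 2 ^ k" .
  qed auto
  then show ?thesis by simp
qed

text \<open>
  The layers coarser than the interval are harmless: they vary by \<open>(1/4) ^ k\<close>, which the
  \<open>k\<close>-th layer exceeds or equals everywhere, since both \<open>weight q k\<close> and \<open>riesz B k x powr q\<close> are
  at least \<open>(1/2) ^ k\<close>.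
  For \<open>k = 0\<close> there is no coarser layer, so intervals of any length are admitted.
\<close>
lemma partial_sum_oscillation:
  assumes B: "1 \<le> B" and q: "0 < q" "q < 1" and xy: "k = 0 \<or> \<bar>x - y\<bar> \<le> scale B (k - 1)"
  shows "\<bar>(\<Sum>j<k. layer q B j x) - (\<Sum>j<k. layer q B j y)\<bar> \<le> (1/4) ^ k"
proof (cases k)
  case (Suc l)
  let ?L = "total_freq B l"
  have L: "1 \<le> ?L" by (rule total_freq_ge_1[OF B])
  have "\<bar>(\<Sum>j<k. layer q B j x) - (\<Sum>j<k. layer q B j y)\<bar>
      \<le> (\<Sum>j<k. \<bar>layer q B j x - layer q B j y\<bar>)"
    by (simp flip: sum_subtractf)
  also have "\<dots> \<le> (\<Sum>j<k. ?L * 2 ^ j * scale B l)"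
  proof (rule sum_mono)
    fix j assume "j \<in> {..<k}"
    then have "total_freq B j \<le> ?L" using total_freq_mono[OF B, of j l] Suc by simp
    then have "total_freq B j * 2 ^ j * \<bar>x - y\<bar> \<le> ?L * 2 ^ j * scale B l"
      using xy Suc L by (intro mult_mono) auto
    then show "\<bar>layer q B j x - layer q B j y\<bar> \<le> ?L * 2 ^ j * scale B l"
      using layer_lipschitz[OF B q, of j x y] by linarith
  qed
  also have "\<dots> = (\<Sum>j<k. 2 ^ j) * (?L * scale B l)"
    by (simp add: sum_distrib_left sum_distrib_right mult_ac)
  also have "\<dots> \<le> 2 ^ k * (?L * scale B l)"
  proof (rule mult_right_mono)
    show "(\<Sum>j<k. (2::real) ^ j) \<le> 2 ^ k" by (induction k) auto
  qed (use L scale_pos[OF B, of l] in auto)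
  also have "\<dots> = (2 / 8) ^ k"
    using L Suc unfolding scale_def power_divide by simp
  finally show ?thesis by simp
qed simp

text \<open>
  The layers finer than the interval are dominated by a geometric series of ratio
  \<open>1 - c / 16\<close> that starts with the \<open>k\<close>-th layer.
\<close>
lemma layer_tail_integrals:
  fixes q :: real
  defines "c \<equiv> q * (1 - q) / 8"
  assumes q: "0 < q" "q < 1" and B: "B = 8 / c" and ab: "a < b" "scale B k \<le> b - a"
  defines "J \<equiv> integral {a..b} (\<lambda>x. riesz B k x powr q)"
  shows "summable (\<lambda>j. integral {a..b} (layer q B j))"
    and "(\<Sum>j. integral {a..b} (layer q B (j + k))) \<le> 16 / c * (weight q k * J)"
proof -
  have c: "0 < c" "c \<le> 1"
    using q mult_mono[of q 1 "1 - q" 1] by (auto simp: c_def)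
  have B1: "1 \<le> B" using c by (simp add: B)
  define r where "r = 1 - c / 16"
  have r: "0 \<le> r" "r < 1" using c by (auto simp: r_def)
  have J: "0 \<le> J" unfolding J_def using continuous_riesz_root
    by (intro integral_nonneg continuous_imp_integrable_on_interval) auto
  have geo: "integral {a..b} (\<lambda>x. riesz B (j + k) x powr q) \<le> r ^ j * J" for j
  proof (induction j)
    case (Suc j)
    have "scale B (j + k) \<le> b - a" using scale_antimono[OF B1, of k "j + k"] ab(2) by simp
    then have "integral {a..b} (\<lambda>x. riesz B (Suc (j + k)) x powr q)
        \<le> r * integral {a..b} (\<lambda>x. riesz B (j + k) x powr q)"
      using riesz_root_integral_Suc[OF q B[unfolded c_def] ab(1)] by (simp add: r_def c_def)
    also have "\<dots> \<le> r * (r ^ j * J)" using Suc r by (intro mult_left_mono) auto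
    finally show ?case by (simp add: mult.assoc)
  qed (simp add: J_def)
  have le: "integral {a..b} (layer q B (j + k)) \<le> weight q k * J * r ^ j" for j
  proof -
    have "integral {a..b} (layer q B (j + k)) = weight q (j + k) * integral {a..b} (\<lambda>x. riesz B (j + k) x powr q)"
      by (simp add: layer_def[abs_def])
    also have "\<dots> \<le> weight q k * (r ^ j * J)"
      using geo[of j] weight_antimono[OF q(1), of k "j + k"] weight_pos[of q k] continuous_riesz_root
      by (intro mult_mono integral_nonneg continuous_imp_integrable_on_interval) auto
    finally show ?thesis by (simp add: mult_ac)
  qed
  have pos: "0 \<le> integral {a..b} (layer q B j)" for j
    using continuous_layer layer_nonneg by (intro integral_nonneg continuous_imp_integrable_on_interval) auto
  have gs: "summable (\<lambda>j. weight q k * J * r ^ j)" using r by (intro summable_mult summable_geometric) auto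
  have sk: "summable (\<lambda>j. integral {a..b} (layer q B (j + k)))"
    using gs by (rule summable_comparison_test'[where N = 0]) (use pos le in auto)
  then show "summable (\<lambda>j. integral {a..b} (layer q B j))" by (subst (asm) summable_iff_shift)
  have "(\<Sum>j. integral {a..b} (layer q B (j + k))) \<le> (\<Sum>j. weight q k * J * r ^ j)"
    by (rule suminf_le[OF le sk gs])
  also have "\<dots> = weight q k * J * (1 / (1 - r))"
    using r by (simp add: suminf_mult summable_geometric suminf_geometric)
  also have "1 / (1 - r) = 16 / c" using c by (simp add: r_def)
  finally show "(\<Sum>j. integral {a..b} (layer q B (j + k))) \<le> 16 / c * (weight q k * J)"
    by (simp add: mult_ac)
qed

text \<open>
  The central estimate.  Its hypotheses say that \<open>k\<close> is the level that belongs to the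
  interval \<open>Q\<close>.  The right-hand side, with a freely chosen \<open>N \<ge> k\<close>, is a measure of \<open>Q\<close>
  and can be added over disjoint intervals of different levels.
\<close>
lemma mean_osc_powr_le:
  fixes p :: real
  defines "q \<equiv> 1 / p"
  defines "c \<equiv> q * (1 - q) / 8"
  assumes p: "1 < p" and B: "B = 8 / c" and Q: "bounded_interval Q"
    and lower: "scale B k \<le> measure lebesgue Q" and upper: "k = 0 \<or> measure lebesgue Q \<le> scale B (k - 1)"
    and kN: "k \<le> N"
  shows "measure lebesgue Q * mean_osc Q (\<lambda>x. \<Sum>j. layer q B j x) powr p
           \<le> 2 * (2 + 32 / c) powr p / real (Suc k) * (LINT x:Q|lebesgue. riesz B N x)"
proof -
  have q: "0 < q" "q < 1" using p by (auto simp: q_def)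
  have c: "0 < c" "c \<le> 1"
    using q mult_mono[of q 1 "1 - q" 1] by (auto simp: c_def)
  have B1: "1 \<le> B" using c by (simp add: B)
  obtain a b where ab: "a < b" and m: "measure lebesgue Q = b - a" and sub: "Q \<subseteq> {a..b}"
    and int: "\<And>f::real \<Rightarrow> real. continuous_on UNIV f \<Longrightarrow> set_integrable lebesgue Q f"
    "\<And>f::real \<Rightarrow> real. continuous_on UNIV f \<Longrightarrow> (LINT x:Q|lebesgue. f x) = integral {a..b} f"
    using bounded_interval_endpoints[OF Q] by metis
  define u where "u = (\<lambda>x. riesz B k x powr q)"
  define z where "z = integral {a..b} u / (b - a)"
  define w where "w = weight q k"
  have w: "0 < w" by (simp add: w_def weight_pos)
  have cu: "continuous_on UNIV u" unfolding u_def by (rule continuous_riesz_root)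
  have "(b - a) * (1/2) ^ k = integral {a..b} (\<lambda>x. (1/2) ^ k)" using ab by simp
  also have "\<dots> \<le> integral {a..b} u"
    using cu riesz_root_lower[OF q] by (intro integral_le continuous_imp_integrable_on_interval) (auto simp: u_def)
  finally have z: "(1/2) ^ k \<le> z" using ab by (simp add: z_def field_simps)
  have z0: "0 \<le> z" using order_trans[OF _ z, of 0] by simp
  note tail = layer_tail_integrals[OF q B[unfolded c_def] ab lower[unfolded m], folded c_def u_def w_def]
  have il: "(LINT x:Q|lebesgue. layer q B j x) = integral {a..b} (layer q B j)" for j
    by (rule int(2)[OF continuous_layer])
  have "mean_osc Q (\<lambda>x. \<Sum>j. layer q B j x)
    \<le> 2 * ((1/4) ^ k + (\<Sum>j. LINT x:Q|lebesgue. layer q B (j + k) x) / measure lebesgue Q)"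
  proof (rule mean_osc_suminf_le[OF Q int(1)[OF continuous_layer] layer_nonneg])
    show "summable (\<lambda>j. LINT x:Q|lebesgue. layer q B j x)" unfolding il by (rule tail(1))
    fix x y assume "x \<in> Q" "y \<in> Q"
    then have "\<bar>x - y\<bar> \<le> b - a" using sub by (auto simp: abs_le_iff subset_iff) (smt (verit))+
    then show "\<bar>(\<Sum>j<k. layer q B j x) - (\<Sum>j<k. layer q B j y)\<bar> \<le> (1/4) ^ k"
      using upper m by (intro partial_sum_oscillation[OF B1 q]) auto
  qed
  also have "\<dots> \<le> 2 * (w * z + 16 / c * (w * integral {a..b} u) / (b - a))"
  proof -
    have "(1/4::real) ^ k = (1/2) ^ k * (1/2) ^ k" by (simp flip: power_mult_distrib)
    also have "\<dots> \<le> w * z" using weight_ge[OF q, of k] z w by (intro mult_mono) (auto simp: w_def)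
    finally show ?thesis
      using tail(2) ab unfolding il m by (intro mult_left_mono add_mono divide_right_mono) auto
  qed
  also have "\<dots> = (2 + 32 / c) * (w * z)"
    by (simp add: z_def distrib_left distrib_right add_divide_distrib mult_ac)
  finally have osc: "mean_osc Q (\<lambda>x. \<Sum>j. layer q B j x) \<le> (2 + 32 / c) * (w * z)" .
  have osc0: "0 \<le> mean_osc Q h" for h
    unfolding mean_osc_def avg_def set_lebesgue_integral_def
    by (intro mult_nonneg_nonneg integral_nonneg_AE) auto
  have "(b - a) * z powr p \<le> integral {a..b} (\<lambda>x. u x powr p)"
    unfolding z_def using riesz_pos[of B k]
    by (intro powr_mean_le[OF p ab cu]) (simp add: u_def less_imp_neq[symmetric])
  also have "(\<lambda>x. u x powr p) = riesz B k"
    using p riesz_pos[of B k] by (auto simp: u_def powr_powr q_def less_imp_le)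
  also have "integral {a..b} (riesz B k) \<le> 2 * integral {a..b} (riesz B N)"
    using riesz_integral_comparable(1)[OF B1 ab _ kN] lower m by simp
  finally have mean: "(b - a) * z powr p \<le> 2 * integral {a..b} (riesz B N)" .
  have "measure lebesgue Q * mean_osc Q (\<lambda>x. \<Sum>j. layer q B j x) powr p
      \<le> (b - a) * ((2 + 32 / c) * (w * z)) powr p"
    unfolding m using ab p osc osc0 by (intro mult_left_mono powr_mono2) auto
  also have "\<dots> = (2 + 32 / c) powr p * w powr p * ((b - a) * z powr p)"
    using c w z0 by (simp add: powr_mult)
  also have "\<dots> \<le> (2 + 32 / c) powr p * w powr p * (2 * integral {a..b} (riesz B N))"
    using mean by (intro mult_left_mono) auto
  also have "w powr p = 1 / real (Suc k)" using p weight_powr[of p k] by (simp add: w_def q_def)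
  finally show ?thesis by (simp add: int(2)[OF continuous_riesz] mult_ac)
qed

text \<open>
  The hypothesis on \<open>k0\<close> says that every interval of the family has level at least \<open>k0\<close>.
\<close>
lemma layers_JN_sum_le:
  fixes p :: real
  defines "q \<equiv> 1 / p"
  defines "c \<equiv> q * (1 - q) / 8"
  assumes p: "1 < p" and B: "B = 8 / c" and Q0: "bounded_interval Q0"
  obtains K :: real where "0 \<le> K"
    and "\<And>\<Q> k0. \<Q> \<in> disjoint_intervals Q0 \<Longrightarrow> (\<And>Q k. Q \<in> \<Q> \<Longrightarrow> k < k0 \<Longrightarrow> measure lebesgue Q < scale B k)
      \<Longrightarrow> JN_sum p (\<lambda>x. \<Sum>j. layer q B j x) \<Q> \<le> ennreal (K / real (Suc k0))"
proof -
  have q: "0 < q" "q < 1" using p by (auto simp: q_def)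
  have c: "0 < c" "c \<le> 1"
    using q mult_mono[of q 1 "1 - q" 1] by (auto simp: c_def)
  have B1: "1 \<le> B" using c by (simp add: B)
  let ?g = "\<lambda>x. \<Sum>j. layer q B j x"
  obtain a b where ab: "a < b"
    and int: "\<And>f::real \<Rightarrow> real. continuous_on UNIV f \<Longrightarrow> set_integrable lebesgue Q0 f"
    "\<And>f::real \<Rightarrow> real. continuous_on UNIV f \<Longrightarrow> (LINT x:Q0|lebesgue. f x) = integral {a..b} f"
    using bounded_interval_endpoints[OF Q0] by metis
  define C where "C = 2 * (2 + 32 / c) powr p"
  have C: "0 \<le> C" by (simp add: C_def)
  define K where "K = C * (2 * (b + 1 - a))"
  \<comment> \<open>One unit is added to the interval because the comparison with \<open>v\<^sub>0 = 1\<close> needs a length of at least \<open>scale B 0\<close>, and \<open>Q0\<close> may be shorter.\<close>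
  have total: "(LINT x:Q0|lebesgue. riesz B N x) \<le> 2 * (b + 1 - a)" for N
  proof -
    have "(LINT x:Q0|lebesgue. riesz B N x) = integral {a..b} (riesz B N)"
      by (rule int(2)[OF continuous_riesz])
    also have "\<dots> \<le> integral {a..b + 1} (riesz B N)"
      using continuous_riesz less_imp_le[OF riesz_pos]
      by (intro integral_subset_le continuous_imp_integrable_on_interval) auto
    also have "\<dots> \<le> 2 * integral {a..b + 1} (riesz B 0)"
      using scale_le[OF B1, of 0] ab by (intro riesz_integral_comparable(2)[OF B1]) auto
    also have "\<dots> = 2 * (b + 1 - a)" using ab by (simp add: riesz_def[abs_def])
    finally show ?thesis .
  qed
  show ?thesis
  proof
    show "0 \<le> K" using C ab by (simp add: K_def)
    fix \<Q> k0
    assume \<Q>: "\<Q> \<in> disjoint_intervals Q0"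
      and small: "\<And>Q k. Q \<in> \<Q> \<Longrightarrow> k < k0 \<Longrightarrow> measure lebesgue Q < scale B k"
    have bi: "bounded_interval Q" "Q \<subseteq> Q0" if "Q \<in> \<Q>" for Q
      using \<Q> that by (auto simp: disjoint_intervals_def)
    \<comment> \<open>The level of \<open>Q\<close>: the first scale that does not exceed its length.\<close>
    define kk where "kk Q = (LEAST k. scale B k \<le> measure lebesgue Q)" for Q :: "real set"
    have ex: "\<exists>k. scale B k \<le> measure lebesgue Q" if "Q \<in> \<Q>" for Q
    proof -
      have "0 < measure lebesgue Q" using bi[OF that] by (simp add: bounded_interval_def)
      then obtain k where "(1/8) ^ k < measure lebesgue Q"
        using real_arch_pow_inv[of "measure lebesgue Q" "1/8"] by auto
      then show ?thesis using scale_le[OF B1, of k] by (intro exI[of _ k]) linarith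
    qed
    have kk1: "scale B (kk Q) \<le> measure lebesgue Q" if "Q \<in> \<Q>" for Q
      unfolding kk_def using ex[OF that] by (rule LeastI_ex)
    have kk2: "kk Q = 0 \<or> measure lebesgue Q \<le> scale B (kk Q - 1)" for Q
      using not_less_Least[of "kk Q - 1" "\<lambda>k. scale B k \<le> measure lebesgue Q"]
      by (cases "kk Q") (auto simp: kk_def[symmetric])
    have kk3: "k0 \<le> kk Q" if "Q \<in> \<Q>" for Q
      using small[OF that, of "kk Q"] kk1[OF that] by (meson leD leI)
    have fin: "(\<Sum>Q\<in>F. measure lebesgue Q * mean_osc Q ?g powr p) \<le> K / real (Suc k0)"
      if F: "finite F" "F \<subseteq> \<Q>" for F
    proof -
      obtain N where N: "\<And>Q. Q \<in> F \<Longrightarrow> kk Q \<le> N"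
        using F(1) by (meson finite_nat_set_iff_bounded_le finite_imageI imageI)
      have sets: "Q \<in> sets lebesgue" if "Q \<in> F" for Q
        using bounded_interval_endpoints[OF bi(1)] that F(2) by (metis fmeasurableD subsetD)
      have int_riesz: "set_integrable lebesgue Q (riesz B N)" if "Q \<in> F" for Q
        using bounded_interval_endpoints[OF bi(1)] that F(2) continuous_riesz[of B N] by (metis subsetD)
      have pos: "0 \<le> (LINT x:Q|lebesgue. riesz B N x)" for Q
        unfolding set_lebesgue_integral_def using riesz_pos less_imp_le
        by (intro integral_nonneg_AE) (auto simp: indicator_def less_imp_le)
      have "(\<Sum>Q\<in>F. measure lebesgue Q * mean_osc Q ?g powr p)
          \<le> (\<Sum>Q\<in>F. C / real (Suc k0) * (LINT x:Q|lebesgue. riesz B N x))"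
      proof (rule sum_mono)
        fix Q assume Q: "Q \<in> F"
        then have Q': "Q \<in> \<Q>" using F by auto
        have "measure lebesgue Q * mean_osc Q ?g powr p
            \<le> C / real (Suc (kk Q)) * (LINT x:Q|lebesgue. riesz B N x)"
          using mean_osc_powr_le[OF p B[unfolded c_def q_def] bi(1)[OF Q'] kk1[OF Q'] kk2 N[OF Q]]
          by (simp add: C_def c_def q_def)
        also have "\<dots> \<le> C / real (Suc k0) * (LINT x:Q|lebesgue. riesz B N x)"
          using C pos kk3[OF Q'] by (intro mult_right_mono divide_left_mono) auto
        finally show "measure lebesgue Q * mean_osc Q ?g powr p
            \<le> C / real (Suc k0) * (LINT x:Q|lebesgue. riesz B N x)" .
      qed
      also have "\<dots> = C / real (Suc k0) * (\<Sum>Q\<in>F. LINT x:Q|lebesgue. riesz B N x)"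
        by (simp add: sum_distrib_left)
      also have "(\<Sum>Q\<in>F. LINT x:Q|lebesgue. riesz B N x) = (LINT x:(\<Union>Q\<in>F. Q)|lebesgue. riesz B N x)"
        using \<Q> F sets int_riesz
        by (intro set_integral_finite_Union[symmetric])
          (auto simp: disjoint_intervals_def disjoint_family_on_def pairwise_def disjnt_def subset_iff)
      also have "\<dots> \<le> (LINT x:Q0|lebesgue. riesz B N x)"
      proof -
        have "(\<Union>Q\<in>F. Q) \<in> sets lebesgue" using F(1) sets by auto
        moreover have "(\<Union>Q\<in>F. Q) \<subseteq> Q0" using F(2) bi(2) by auto
        moreover from calculation have "set_integrable lebesgue (\<Union>Q\<in>F. Q) (riesz B N)"
          by (rule set_integrable_subset[OF int(1)[OF continuous_riesz]])
        ultimately show ?thesis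
          using int(1)[OF continuous_riesz, of B N] less_imp_le[OF riesz_pos[of B N]]
          unfolding set_lebesgue_integral_def set_integrable_def
          by (intro integral_mono) (auto simp: indicator_def)
      qed
      also have "\<dots> \<le> 2 * (b + 1 - a)" by (rule total)
      finally show ?thesis using C by (simp add: K_def mult_left_mono divide_right_mono)
    qed
    show "JN_sum p ?g \<Q> \<le> ennreal (K / real (Suc k0))"
      unfolding JN_sum_def
    proof (rule infsum_le_finite_sums[OF nonneg_summable_on_complete])
      fix F assume F: "finite F" "F \<subseteq> \<Q>"
      have "(\<Sum>Q\<in>F. ennreal (measure lebesgue Q * mean_osc Q ?g powr p))
          = ennreal (\<Sum>Q\<in>F. measure lebesgue Q * mean_osc Q ?g powr p)"
        by (intro sum_ennreal) auto
      also have "\<dots> \<le> ennreal (K / real (Suc k0))" using fin[OF F] by (intro ennreal_leI)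
      finally show "(\<Sum>Q\<in>F. ennreal (measure lebesgue Q * mean_osc Q ?g powr p)) \<le> ennreal (K / real (Suc k0))" .
    qed auto
  qed
qed

text \<open>
  On \<open>Q0\<close> every \<open>v\<^sub>j\<close> with \<open>j \<ge> k\<close> has at least half the integral of \<open>v\<^sub>k\<close>, once \<open>Q0\<close> is
  at least as long as the scale of \<open>k\<close>.  As the \<open>p\<close>-th power is superadditive, the partial sums
  of the harmonic series would be bounded by a multiple of \<open>\<integral> \<bar>g\<bar> powr p\<close>.
\<close>
lemma layers_not_Lp:
  fixes p :: real
  defines "q \<equiv> 1 / p"
  defines "c \<equiv> q * (1 - q) / 8"
  assumes p: "1 < p" and B: "B = 8 / c" and Q0: "bounded_interval Q0"
  shows "set_integrable lebesgue Q0 (\<lambda>x. \<Sum>j. layer q B j x)"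
    and "\<not> set_integrable lebesgue Q0 (\<lambda>x. \<bar>\<Sum>j. layer q B j x\<bar> powr p)"
proof -
  have q: "0 < q" "q < 1" using p by (auto simp: q_def)
  have c: "0 < c" "c \<le> 1"
    using q mult_mono[of q 1 "1 - q" 1] by (auto simp: c_def)
  have B1: "1 \<le> B" using c by (simp add: B)
  let ?g = "\<lambda>x. \<Sum>j. layer q B j x"
  obtain a b where ab: "a < b" and m: "measure lebesgue Q0 = b - a"
    and int: "\<And>f::real \<Rightarrow> real. continuous_on UNIV f \<Longrightarrow> set_integrable lebesgue Q0 f"
    "\<And>f::real \<Rightarrow> real. continuous_on UNIV f \<Longrightarrow> (LINT x:Q0|lebesgue. f x) = integral {a..b} f"
    using bounded_interval_endpoints[OF Q0] by metis
  obtain k where "(1/8) ^ k < b - a"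
    using real_arch_pow_inv[of "b - a" "1/8"] ab by auto
  then have k: "scale B k \<le> b - a" using scale_le[OF B1, of k] by linarith
  have "summable (\<lambda>j. LINT x:Q0|lebesgue. layer q B j x)"
    unfolding int(2)[OF continuous_layer]
    by (rule layer_tail_integrals(1)[OF q B[unfolded c_def] ab k])
  note S = set_integral_suminf_nonneg[OF int(1)[OF continuous_layer] layer_nonneg this]
  show "set_integrable lebesgue Q0 ?g" by (rule S(2))
  show "\<not> set_integrable lebesgue Q0 (\<lambda>x. \<bar>?g x\<bar> powr p)"
  proof
    assume gp: "set_integrable lebesgue Q0 (\<lambda>x. \<bar>?g x\<bar> powr p)"
    define G where "G = (LINT x:Q0|lebesgue. \<bar>?g x\<bar> powr p)"
    define J where "J = integral {a..b} (riesz B k)"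
    have "(b - a) * (1/2) ^ k = integral {a..b} (\<lambda>x. (1/2) ^ k)" using ab by simp
    also have "\<dots> \<le> J"
      unfolding J_def using riesz_lower by (intro integral_le continuous_imp_integrable_on_interval continuous_riesz) auto
    finally have J: "0 < J" using ab by (meson divide_pos_pos less_le_trans mult_pos_pos zero_less_power zero_less_one zero_less_numeral diff_gt_0_iff_gt)
    have bound: "(\<Sum>j<n. 1 / real (Suc (j + k)) * (J / 2)) \<le> G" for n
    proof -
      let ?F = "\<lambda>x. \<Sum>j<n. 1 / real (Suc (j + k)) * riesz B (j + k) x"
      have cF: "continuous_on UNIV ?F" by (intro continuous_intros continuous_riesz)
      have "(\<Sum>j<n. 1 / real (Suc (j + k)) * (J / 2))
          \<le> (\<Sum>j<n. 1 / real (Suc (j + k)) * integral {a..b} (riesz B (j + k)))"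
        using riesz_integral_comparable(1)[OF B1 ab k le_add2]
        by (intro sum_mono mult_left_mono) (auto simp: J_def field_simps)
      also have "\<dots> = integral {a..b} ?F"
        using continuous_riesz
        by (subst integral_sum) (auto intro!: continuous_imp_integrable_on_interval continuous_intros)
      also have "\<dots> = (LINT x:Q0|lebesgue. ?F x)" by (rule int(2)[OF cF, symmetric])
      also have "\<dots> \<le> G"
        unfolding G_def
      proof (rule set_integral_mono_AE[OF int(1)[OF cF] gp])
        show "AE x\<in>Q0 in lebesgue. ?F x \<le> \<bar>?g x\<bar> powr p"
          using S(1)
        proof eventually_elim
          case (elim x)
          show ?case
          proof
            assume "x \<in> Q0"
            then have s: "summable (\<lambda>j. layer q B j x)" using elim by simp
            have "?F x = (\<Sum>j<n. layer q B (j + k) x powr p)"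
              using p weight_powr[of p] riesz_pos[of B] weight_pos[of q]
              by (intro sum.cong refl) (simp add: layer_def powr_mult powr_powr q_def less_imp_le)
            also have "\<dots> \<le> (\<Sum>j<n. layer q B (j + k) x) powr p"
              using p layer_nonneg by (intro sum_powr_superadditive) auto
            also have "(\<Sum>j<n. layer q B (j + k) x) = (\<Sum>j\<in>{k..<n + k}. layer q B j x)"
              using sum.shift_bounds_nat_ivl[of "\<lambda>j. layer q B j x" 0 k n] by (simp add: lessThan_atLeast0)
            also have "\<dots> powr p \<le> \<bar>?g x\<bar> powr p"
              using p layer_nonneg sum_le_suminf[OF s, of "{k..<n + k}"]
              by (intro powr_mono2 sum_nonneg) (auto intro: order_trans[OF _ abs_ge_self])
            finally show "?F x \<le> \<bar>?g x\<bar> powr p" .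
          qed
        qed
      qed
      finally show ?thesis .
    qed
    have "summable (\<lambda>j. 1 / real (Suc (j + k)) * (J / 2))"
      using bound J by (intro summableI_nonneg_bounded) auto
    then have "summable (\<lambda>j. 1 / real (Suc (j + k)))"
      using J by (subst (asm) summable_cmult_iff[where c = "J / 2", simplified mult.commute]) auto
    then have "summable (\<lambda>j. inverse (real (j + Suc k)))" by (simp add: divide_inverse)
    then have "summable (\<lambda>j. inverse (real j))" by (subst (asm) summable_iff_shift)
    then show False using not_summable_harmonic[where 'a = real] by simp
  qed
qed

theorem proposition4p4:
  fixes p :: real and Q0 :: "real set"
  assumes "1 < p"
    and "bounded_interval Q0"
  shows "\<exists>g0 :: real \<Rightarrow> real. g0 \<in> VJN p Q0 - Lp p Q0"
proof -
  define q c B where "q = 1 / p" and "c = q * (1 - q) / 8" and "B = 8 / c"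
  have q: "0 < q" "q < 1" using assms by (auto simp: q_def)
  have c: "0 < c" "c \<le> 1"
    using q mult_mono[of q 1 "1 - q" 1] by (auto simp: c_def)
  have B1: "1 \<le> B" using c by (simp add: B_def)
  note B = B_def[unfolded c_def q_def]
  define g where "g x = (\<Sum>j. layer q B j x)" for x
  note nLp = layers_not_Lp[OF assms(1) B assms(2), folded q_def g_def]
  obtain K where K: "0 \<le> K" "\<And>\<Q> k0. \<Q> \<in> disjoint_intervals Q0 \<Longrightarrow>
      (\<And>Q k. Q \<in> \<Q> \<Longrightarrow> k < k0 \<Longrightarrow> measure lebesgue Q < scale B k)
      \<Longrightarrow> JN_sum p g \<Q> \<le> ennreal (K / real (Suc k0))"
    using layers_JN_sum_le[OF assms(1) B assms(2), folded q_def] unfolding g_def[abs_def] by metis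
  have "g \<in> JN p Q0"
    unfolding JN_def
  proof (intro CollectI conjI exI[of _ "K powr q"] ballI)
    show "set_integrable lebesgue Q0 g" using nLp(1) by (simp add: g_def[abs_def])
    fix \<Q> assume "\<Q> \<in> disjoint_intervals Q0"
    then show "JN_sum p g \<Q> \<le> ennreal ((K powr q) powr p)"
      using K(2)[of \<Q> 0] K(1) assms by (simp add: powr_powr q_def)
  qed simp
  moreover have "((\<lambda>a. SUP \<Q>\<in>{\<Q>\<in>disjoint_intervals Q0. \<forall>Q\<in>\<Q>. measure lebesgue Q \<le> a}. JN_sum p g \<Q>)
        \<longlongrightarrow> 0) (at_right (0::real))"
  proof (rule order_tendstoI)
    fix e :: ennreal assume e: "0 < e"
    have "(\<lambda>n. ennreal (K / real (Suc n))) \<longlonglongrightarrow> ennreal 0"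
      using LIMSEQ_Suc[OF lim_const_over_n[of K]] by (intro tendsto_ennrealI) simp
    then have "\<forall>\<^sub>F n in sequentially. ennreal (K / real (Suc n)) < e"
      using e by (intro order_tendstoD) auto
    then obtain n where n: "ennreal (K / real (Suc n)) < e"
      by (meson eventually_happens trivial_limit_sequentially)
    have "\<forall>\<^sub>F a in at_right (0::real). a < scale B n"
      using scale_pos[OF B1, of n] by (intro order_tendstoD[OF tendsto_ident_at])
    then show "\<forall>\<^sub>F a in at_right 0.
       (SUP \<Q>\<in>{\<Q>\<in>disjoint_intervals Q0. \<forall>Q\<in>\<Q>. measure lebesgue Q \<le> a}. JN_sum p g \<Q>) < e"
    proof eventually_elim
      case (elim a)
      have "(SUP \<Q>\<in>{\<Q>\<in>disjoint_intervals Q0. \<forall>Q\<in>\<Q>. measure lebesgue Q \<le> a}. JN_sum p g \<Q>)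
          \<le> ennreal (K / real (Suc n))"
      proof (rule SUP_least)
        fix \<Q> assume \<Q>: "\<Q> \<in> {\<Q>\<in>disjoint_intervals Q0. \<forall>Q\<in>\<Q>. measure lebesgue Q \<le> a}"
        show "JN_sum p g \<Q> \<le> ennreal (K / real (Suc n))"
        proof (rule K(2))
          fix Q k assume "Q \<in> \<Q>" "k < n"
          then show "measure lebesgue Q < scale B k"
            using \<Q> elim scale_antimono[OF B1, of k n] by fastforce
        qed (use \<Q> in simp)
      qed
      with n show ?case by simp
    qed
  qed simp
  ultimately have "g \<in> VJN p Q0" by (simp add: VJN_def)
  moreover have "g \<notin> Lp p Q0" using nLp(2) by (simp add: Lp_def g_def)
  ultimately show ?thesis by blast
qed

end
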